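(* Let $k$ be a field, $\mathfrak{L}$ a Leibniz algebra over $k$, $E$ a $k$-vector space and $\pi:E\to\mathfrak{L}$ a surjective linear map such that $\mathrm{Ker}(\pi)$ has dimension $1$. Then $$\mathrm{Gext}(E,\mathfrak{L})\cong\mathbb{GHL}^2(\mathfrak{L},k)\cong\mathcal{CF}(\mathfrak{L})/\approx,$$ where $\approx$ is the following equivalence relation on $\mathcal{CF}(\mathfrak{L})$: $(\lambda,\Lambda,f)\approx(\lambda',\Lambda',f')$ if and only if $\lambda=\lambda'$, $\Lambda=\Lambda'$ and there exists a linear map $r:\mathfrak{L}\to k$ such that for any $x,y\in\mathfrak{L}$: $$f(x,y) = f'(x,y) - r([x,y]) + \Lambda(x)r(y) + r(x)\lambda(y).$$ The bijection between $\mathcal{CF}(\mathfrak{L})/\approx$ and $\mathrm{Gext}(E,\mathfrak{L})$ is given by $\overline{(\lambda,\Lambda,f)}\mapsto\mathfrak{L}_{(\lambda,\Lambda,f)}$.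
   Context: All vector spaces and (bi)linear maps are over an arbitrary field $k$. A Leibniz algebra is a vector space with a bilinear bracket satisfying $[x,[y,z]] = [[x,y],z] - [[x,z],y]$. Co-flag data: a co-flag datum of $\mathfrak{L}$ is a triple $(\lambda,\Lambda,f)$, with $\lambda,\Lambda:\mathfrak{L}\to k$ linear and $f:\mathfrak{L}\times\mathfrak{L}\to k$ bilinear, such that for all $x,y,z\in\mathfrak{L}$: $\lambda([x,y])=\Lambda([x,y])=0$; $\Lambda(x)\Lambda(y) = -\Lambda(x)\lambda(y)$; and $f([x,y],z)-f([x,z],y)-f(x,[y,z]) = \Lambda(x)f(y,z)-\lambda(z)f(x,y)+\lambda(y)f(x,z)$. $\mathcal{CF}(\mathfrak{L})$ is the set of all co-flag data. For such a datum, $\mathfrak{L}_{(\lambda,\Lambda,f)}$ is the Leibniz algebra $k\times\mathfrak{L}$ with bracket $\{(\alpha,x),(\beta,y)\} = (\alpha\lambda(y)+\beta\Lambda(x)+f(x,y),[x,y])$. Crossed systems: for a vector space $\mathfrak{g}$, a crossed system of $\mathfrak{L}$ by $\mathfrak{g}$ is a quadruple $(\triangleleft,\triangleright,f,[-,-]_{\mathfrak{g}})$ of bilinear maps $\triangleleft : \mathfrak{g}\times\mathfrak{L}\to\mathfrak{g}$, $\triangleright : \mathfrak{L}\times\mathfrak{g}\to\mathfrak{g}$, $f : \mathfrak{L}\times\mathfrak{L}\to\mathfrak{g}$, $[-,-]_{\mathfrak{g}} : \mathfrak{g}\times\mathfrak{g}\to\mathfrak{g}$ such that $\mathfrak{g}\times\mathfrak{L}$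 with the bracket $\{(g,x),(h,y)\} := ([g,h]_{\mathfrak{g}} + x\triangleright h + g\triangleleft y + f(x,y), [x,y])$ is a Leibniz algebra. Two crossed systems are cohomologous iff $[-,-]_{\mathfrak{g}} = [-,-]'_{\mathfrak{g}}$ and there is a linear map $r:\mathfrak{L}\to\mathfrak{g}$ with $g\triangleleft x = g\triangleleft' x + [g,r(x)]_{\mathfrak{g}}$, $x\triangleright g = x\triangleright' g + [r(x),g]_{\mathfrak{g}}$ and $f(x,y) = f'(x,y) + [r(x),r(y)]_{\mathfrak{g}} - r([x,y]) + x\triangleright' r(y) + r(x)\triangleleft' y$ for all $g\in\mathfrak{g}$, $x,y\in\mathfrak{L}$. $\mathbb{GHL}^2(\mathfrak{L},\mathfrak{g})$ is the set of crossed systems of $\mathfrak{L}$ by $\mathfrak{g}$ modulo this equivalence relation. $\mathrm{Gext}(E,\mathfrak{L})$ is the set of all Leibniz algebra structures on $E$ for which $\pi$ is a morphism of Leibniz algebras, modulo the relation: $\{-,-\}_E\approx\{-,-\}'_E$ iff there is a Leibniz algebra isomorphism $\varphi:(E,\{-,-\}_E)\to(E,\{-,-\}'_E)$ with $\varphi|_{\mathrm{Ker}(\pi)}=\mathrm{Id}$ and $\pi\circ\varphi=\pi$. The one-dimensional space $\mathrm{Ker}(\pi)$ is identified with $k$ by choosing a basis vector $g_0$, and $\mathfrak{L}_{(\lambda,\Lambda,f)}$ is regarded as an element of $\mathrm{Gext}(E,\mathfrak{L})$ by transporting its bracket along a linear isomorphism $k\times\mathfrak{L}\to E$, $(\alpha,x)\mapsto\alpha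 g_0+s(x)$, with $s$ a linear section of $\pi$ (the class does not depend on $s$). *)

theory Defs
  imports "HOL-Analysis.Product_Vector"
begin

text \<open>
  A vector space over the field \<open>'k\<close> is a type with an explicit scalar multiplication satisfying
  \<^locale>\<open>vector_space\<close>; the field itself is the vector space with scalar multiplication \<open>(*)\<close>.
\<close>

definition bilinear_map ::
  "('k::field \<Rightarrow> 'a::ab_group_add \<Rightarrow> 'a) \<Rightarrow> ('k \<Rightarrow> 'b::ab_group_add \<Rightarrow> 'b) \<Rightarrow>
   ('k \<Rightarrow> 'c::ab_group_add \<Rightarrow> 'c) \<Rightarrow> ('a \<Rightarrow> 'b \<Rightarrow> 'c) \<Rightarrow> bool"
  where "bilinear_map s1 s2 s3 B \<longleftrightarrow>
    (\<forall>x. Vector_Spaces.linear s2 s3 (B x)) \<and> (\<forall>y. Vector_Spaces.linear s1 s3 (\<lambda>x. B x y))"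

locale leibniz_algebra = vector_space scale
  for scale :: "'k::field \<Rightarrow> 'l::ab_group_add \<Rightarrow> 'l" +
  fixes bracket :: "'l \<Rightarrow> 'l \<Rightarrow> 'l"
  assumes bracket_bilinear: "bilinear_map scale scale scale bracket"
    and leibniz: "bracket x (bracket y z) = bracket (bracket x y) z - bracket (bracket x z) y"

definition leibniz_hom ::
  "('k::field \<Rightarrow> 'a::ab_group_add \<Rightarrow> 'a) \<Rightarrow> ('a \<Rightarrow> 'a \<Rightarrow> 'a) \<Rightarrow>
   ('k \<Rightarrow> 'b::ab_group_add \<Rightarrow> 'b) \<Rightarrow> ('b \<Rightarrow> 'b \<Rightarrow> 'b) \<Rightarrow> ('a \<Rightarrow> 'b) \<Rightarrow> bool"
  where "leibniz_hom s1 br1 s2 br2 f \<longleftrightarrow>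
    Vector_Spaces.linear s1 s2 f \<and> (\<forall>x y. f (br1 x y) = br2 (f x) (f y))"

definition leibniz_iso ::
  "('k::field \<Rightarrow> 'a::ab_group_add \<Rightarrow> 'a) \<Rightarrow> ('a \<Rightarrow> 'a \<Rightarrow> 'a) \<Rightarrow>
   ('k \<Rightarrow> 'b::ab_group_add \<Rightarrow> 'b) \<Rightarrow> ('b \<Rightarrow> 'b \<Rightarrow> 'b) \<Rightarrow> ('a \<Rightarrow> 'b) \<Rightarrow> bool"
  where "leibniz_iso s1 br1 s2 br2 f \<longleftrightarrow> leibniz_hom s1 br1 s2 br2 f \<and> bij f"


subsection \<open>Co-flag data\<close>

type_synonym ('k, 'l) coflag = "('l \<Rightarrow> 'k) \<times> ('l \<Rightarrow> 'k) \<times> ('l \<Rightarrow> 'l \<Rightarrow> 'k)"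

definition coflag_data ::
  "('k::field \<Rightarrow> 'l::ab_group_add \<Rightarrow> 'l) \<Rightarrow> ('l \<Rightarrow> 'l \<Rightarrow> 'l) \<Rightarrow> ('k, 'l) coflag set"
  where "coflag_data sL br = {(lam, Lam, f).
    Vector_Spaces.linear sL (*) lam \<and> Vector_Spaces.linear sL (*) Lam \<and>
    bilinear_map sL sL (*) f \<and>
    (\<forall>x y. lam (br x y) = 0 \<and> Lam (br x y) = 0) \<and>
    (\<forall>x y. Lam x * Lam y = - (Lam x * lam y)) \<and>
    (\<forall>x y z. f (br x y) z - f (br x z) y - f x (br y z)
              = Lam x * f y z - lam z * f x y + lam y * f x z)}"

definition coflag_rel ::
  "('k::field \<Rightarrow> 'l::ab_group_add \<Rightarrow> 'l) \<Rightarrow> ('l \<Rightarrow> 'l \<Rightarrow> 'l) \<Rightarrow>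
   (('k, 'l) coflag \<times> ('k, 'l) coflag) set"
  where "coflag_rel sL br = {((lam, Lam, f), (lam', Lam', f')).
    (lam, Lam, f) \<in> coflag_data sL br \<and> (lam', Lam', f') \<in> coflag_data sL br \<and>
    lam = lam' \<and> Lam = Lam' \<and>
    (\<exists>r. Vector_Spaces.linear sL (*) r \<and>
      (\<forall>x y. f x y = f' x y - r (br x y) + Lam x * r y + r x * lam y))}"

fun coflag_bracket ::
  "('l \<Rightarrow> 'l \<Rightarrow> 'l) \<Rightarrow> ('k::field, 'l) coflag \<Rightarrow> 'k \<times> 'l \<Rightarrow> 'k \<times> 'l \<Rightarrow> 'k \<times> 'l"
  where "coflag_bracket br (lam, Lam, f) (a, x) (b, y) =
    (a * lam y + b * Lam x + f x y, br x y)"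


subsection \<open>Crossed systems and the cohomological object\<close>

text \<open>
  A crossed system \<open>(\<triangleleft>, \<triangleright>, f, [-,-]\<^sub>\<gg>)\<close> is the quadruple \<open>(la, ra, f, brg)\<close> with
  \<open>la g x = g \<triangleleft> x\<close> and \<open>ra x g = x \<triangleright> g\<close>.
\<close>

type_synonym ('g, 'l) crossed =
  "('g \<Rightarrow> 'l \<Rightarrow> 'g) \<times> ('l \<Rightarrow> 'g \<Rightarrow> 'g) \<times> ('l \<Rightarrow> 'l \<Rightarrow> 'g) \<times> ('g \<Rightarrow> 'g \<Rightarrow> 'g)"

fun crossed_bracket ::
  "('l \<Rightarrow> 'l \<Rightarrow> 'l) \<Rightarrow> ('g::ab_group_add, 'l) crossed \<Rightarrow> 'g \<times> 'l \<Rightarrow> 'g \<times> 'l \<Rightarrow> 'g \<times> 'l"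
  where "crossed_bracket br (la, ra, f, brg) (g, x) (h, y) =
    (brg g h + ra x h + la g y + f x y, br x y)"

definition crossed_systems ::
  "('k::field \<Rightarrow> 'g::ab_group_add \<Rightarrow> 'g) \<Rightarrow> ('k \<Rightarrow> 'l::ab_group_add \<Rightarrow> 'l) \<Rightarrow>
   ('l \<Rightarrow> 'l \<Rightarrow> 'l) \<Rightarrow> ('g, 'l) crossed set"
  where "crossed_systems sg sL br = {(la, ra, f, brg).
    bilinear_map sg sL sg la \<and> bilinear_map sL sg sg ra \<and>
    bilinear_map sL sL sg f \<and> bilinear_map sg sg sg brg \<and>
    leibniz_algebra (module_prod.scale sg sL) (crossed_bracket br (la, ra, f, brg))}"

definition cohomologous ::
  "('k::field \<Rightarrow> 'g::ab_group_add \<Rightarrow> 'g) \<Rightarrow> ('k \<Rightarrow> 'l::ab_group_add \<Rightarrow> 'l) \<Rightarrow>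
   ('l \<Rightarrow> 'l \<Rightarrow> 'l) \<Rightarrow> (('g, 'l) crossed \<times> ('g, 'l) crossed) set"
  where "cohomologous sg sL br = {((la, ra, f, brg), (la', ra', f', brg')).
    (la, ra, f, brg) \<in> crossed_systems sg sL br \<and>
    (la', ra', f', brg') \<in> crossed_systems sg sL br \<and>
    brg = brg' \<and>
    (\<exists>r. Vector_Spaces.linear sL sg r \<and>
      (\<forall>g x. la g x = la' g x + brg g (r x)) \<and>
      (\<forall>x g. ra x g = ra' x g + brg (r x) g) \<and>
      (\<forall>x y. f x y = f' x y + brg (r x) (r y) - r (br x y) + ra' x (r y) + la' (r x) y))}"

definition GHL2 ::
  "('k::field \<Rightarrow> 'g::ab_group_add \<Rightarrow> 'g) \<Rightarrow> ('k \<Rightarrow> 'l::ab_group_add \<Rightarrow> 'l) \<Rightarrow>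
   ('l \<Rightarrow> 'l \<Rightarrow> 'l) \<Rightarrow> ('g, 'l) crossed set set"
  where "GHL2 sg sL br = crossed_systems sg sL br // cohomologous sg sL br"


subsection \<open>The global extension problem\<close>

definition ext_structures ::
  "('k::field \<Rightarrow> 'e::ab_group_add \<Rightarrow> 'e) \<Rightarrow> ('k \<Rightarrow> 'l::ab_group_add \<Rightarrow> 'l) \<Rightarrow>
   ('l \<Rightarrow> 'l \<Rightarrow> 'l) \<Rightarrow> ('e \<Rightarrow> 'l) \<Rightarrow> ('e \<Rightarrow> 'e \<Rightarrow> 'e) set"
  where "ext_structures sE sL br p =
    {brE. leibniz_algebra sE brE \<and> leibniz_hom sE brE sL br p}"

definition ext_rel ::
  "('k::field \<Rightarrow> 'e::ab_group_add \<Rightarrow> 'e) \<Rightarrow> ('k \<Rightarrow> 'l::ab_group_add \<Rightarrow> 'l) \<Rightarrow>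
   ('l \<Rightarrow> 'l \<Rightarrow> 'l) \<Rightarrow> ('e \<Rightarrow> 'l) \<Rightarrow> (('e \<Rightarrow> 'e \<Rightarrow> 'e) \<times> ('e \<Rightarrow> 'e \<Rightarrow> 'e)) set"
  where "ext_rel sE sL br p = {(brE, brE').
    brE \<in> ext_structures sE sL br p \<and> brE' \<in> ext_structures sE sL br p \<and>
    (\<exists>\<phi>. leibniz_iso sE brE sE brE' \<phi> \<and> (\<forall>v. p v = 0 \<longrightarrow> \<phi> v = v) \<and> p \<circ> \<phi> = p)}"

definition Gext ::
  "('k::field \<Rightarrow> 'e::ab_group_add \<Rightarrow> 'e) \<Rightarrow> ('k \<Rightarrow> 'l::ab_group_add \<Rightarrow> 'l) \<Rightarrow>
   ('l \<Rightarrow> 'l \<Rightarrow> 'l) \<Rightarrow> ('e \<Rightarrow> 'l) \<Rightarrow> ('e \<Rightarrow> 'e \<Rightarrow> 'e) set set"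
  where "Gext sE sL br p = ext_structures sE sL br p // ext_rel sE sL br p"

definition transport_bracket :: "('a \<Rightarrow> 'b) \<Rightarrow> ('a \<Rightarrow> 'a \<Rightarrow> 'a) \<Rightarrow> 'b \<Rightarrow> 'b \<Rightarrow> 'b"
  where "transport_bracket T br u v = T (br (inv T u) (inv T v))"

definition splitting :: "('k \<Rightarrow> 'e \<Rightarrow> 'e) \<Rightarrow> 'e \<Rightarrow> ('l \<Rightarrow> 'e) \<Rightarrow> 'k \<times> 'l \<Rightarrow> 'e::ab_group_add"
  where "splitting sE g0 s = (\<lambda>(a, x). sE a g0 + s x)"

text \<open>
  The bracket of \<open>\<LL>\<^bsub>(\<lambda>,\<Lambda>,f)\<^esub>\<close> on \<open>E\<close>, transported along \<open>(\<alpha>, x) \<mapsto> \<alpha> g\<^sub>0 + s x\<close>; this map is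
  bijective when \<open>g\<^sub>0\<close> is a basis vector of the kernel of \<open>p\<close> and \<open>s\<close> a linear section of \<open>p\<close>.
\<close>

definition coflag_structure ::
  "('k::field \<Rightarrow> 'e::ab_group_add \<Rightarrow> 'e) \<Rightarrow> ('l \<Rightarrow> 'l \<Rightarrow> 'l) \<Rightarrow> 'e \<Rightarrow> ('l \<Rightarrow> 'e) \<Rightarrow>
   ('k, 'l) coflag \<Rightarrow> 'e \<Rightarrow> 'e \<Rightarrow> 'e"
  where "coflag_structure sE br g0 s d =
    transport_bracket (splitting sE g0 s) (coflag_bracket br d)"

end

theory Submission
  imports Defs
begin

text \<open>
  On a one-dimensional kernel \<open>[g, h] = c g h\<close>, and the Leibniz identity at \<open>(1, 1, 1)\<close> forces
  \<open>c\<^sup>2 = 0\<close>. Hence a crossed system by \<open>k\<close> is \<open>g \<triangleleft> x = g \<lambda>(x)\<close>, \<open>x \<triangleright> g = \<Lambda>(x) g\<close>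
  together with \<open>f\<close>, and expanding the Leibniz identity gives exactly the axioms of a co-flag datum.
  After a linear section \<open>s\<close> of \<open>\<pi>\<close> is chosen, \<open>E\<close> is identified with \<open>k \<times> \<LL>\<close>, every Leibniz structure
  on \<open>E\<close> over \<open>\<LL>\<close> comes from a unique co-flag datum, and the isomorphisms stabilizing the kernel and
  costabilizing \<open>\<LL>\<close> are the shears \<open>(a, x) \<mapsto> (a + r(x), x)\<close>. So both bijections
  already exist before passing to quotients and they match the three relations.
\<close>

section \<open>Transfer of equivalence relations along bijections\<close>

text \<open>Every related pair in \<open>B\<close> pulls back along \<open>h\<close>, so the
  equivalence axioms transfer. Only the relation on co-flag data then has to be checked by hand;
  those on crossed systems and on extensions inherit the property.\<close>

lemma equiv_bij_betw:
  assumes "equiv A R" "bij_betw h A B" "S \<subseteq> B \<times> B"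
    and iff: "\<And>x y. x \<in> A \<Longrightarrow> y \<in> A \<Longrightarrow> (h x, h y) \<in> S \<longleftrightarrow> (x, y) \<in> R"
  shows "equiv B S"
proof (rule equivI)
  have B: "B = h ` A" using assms(2) by (simp add: bij_betw_def)
  have R: "R \<subseteq> A \<times> A" "refl_on A R" "sym R" "trans R"
    using assms(1) by (simp_all add: equiv_def)
  show "S \<subseteq> B \<times> B" by fact
  show "refl_on B S"
    using R iff unfolding B refl_on_def by blast
  show "sym S"
    using R iff assms(3) unfolding B sym_def by blast
  show "trans S"
  proof (rule transI)
    fix u v w assume uvw: "(u, v) \<in> S" "(v, w) \<in> S"
    then obtain x y z where "x \<in> A" "y \<in> A" "z \<in> A" "u = h x" "v = h y" "w = h z"
      using assms(3) unfolding B by blast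
    then show "(u, w) \<in> S"
      using uvw iff transD[OF R(4), of x y z] by simp
  qed
qed

text \<open>Since \<open>S\<close> lies in \<open>B \<times> B\<close>, everything related to
  \<open>h x\<close> is itself in the image of \<open>h\<close>. This gives the explicit formula for
  the class attached to a co-flag datum.\<close>

lemma bij_betw_image_class:
  assumes "equiv A R" "bij_betw h A B" "S \<subseteq> B \<times> B"
    and iff: "\<And>x y. x \<in> A \<Longrightarrow> y \<in> A \<Longrightarrow> (h x, h y) \<in> S \<longleftrightarrow> (x, y) \<in> R"
    and "x \<in> A"
  shows "h ` (R `` {x}) = S `` {h x}"
proof -
  have B: "B = h ` A" using assms(2) by (simp add: bij_betw_def)
  have "R \<subseteq> A \<times> A" using assms(1) by (simp add: equiv_def)
  then show ?thesis using assms(3,5) iff unfolding B by blast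
qed

text \<open>Taking images preserves distinctness of classes because these are subsets of
  \<open>A\<close>, where \<open>h\<close> is injective; surjectivity follows by computing the image
  of each class.\<close>

lemma bij_betw_image_quotient:
  assumes "equiv A R" "bij_betw h A B" "S \<subseteq> B \<times> B"
    and iff: "\<And>x y. x \<in> A \<Longrightarrow> y \<in> A \<Longrightarrow> (h x, h y) \<in> S \<longleftrightarrow> (x, y) \<in> R"
  shows "bij_betw ((`) h) (A // R) (B // S)"
proof -
  have B: "B = h ` A" and inj: "inj_on h A" using assms(2) by (simp_all add: bij_betw_def)
  have sub: "C \<subseteq> A" if "C \<in> A // R" for C
    using that assms(1) by (auto simp: quotient_def equiv_def)
  have "inj_on ((`) h) (A // R)"
    by (rule inj_onI) (metis inj inj_on_image_eq_iff sub)
  moreover have "(`) h ` (A // R) = B // S"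
  proof -
    have "(`) h ` (A // R) = (\<lambda>x. h ` (R `` {x})) ` A"
      by (auto simp: quotient_def)
    also have "\<dots> = (\<lambda>x. S `` {h x}) ` A"
      using bij_betw_image_class[OF assms] by simp
    also have "\<dots> = B // S" by (auto simp: quotient_def B)
    finally show ?thesis .
  qed
  ultimately show ?thesis by (simp add: bij_betw_def)
qed

section \<open>Leibniz brackets on products and their transport\<close>

lemma linear_map_zero:
  assumes "Vector_Spaces.linear s1 s2 f"
  shows "f 0 = 0"
proof -
  have "f (0 + 0) = f 0 + f 0"
    using assms unfolding Vector_Spaces.linear_iff by blast
  then show ?thesis by simp
qed

lemma bilinear_map_iff:
  "bilinear_map s1 s2 s3 B \<longleftrightarrow> vector_space s1 \<and> vector_space s2 \<and> vector_space s3 \<and>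
    (\<forall>x y z. B (x + y) z = B x z + B y z) \<and> (\<forall>x y z. B x (y + z) = B x y + B x z) \<and>
    (\<forall>c x y. B (s1 c x) y = s3 c (B x y)) \<and> (\<forall>c x y. B x (s2 c y) = s3 c (B x y))"
  unfolding bilinear_map_def Vector_Spaces.linear_iff by blast

lemma bilinear_map_zero:
  assumes "bilinear_map s1 s2 s3 B"
  shows "B 0 y = 0" "B x 0 = 0"
proof -
  have "B (0 + 0) y = B 0 y + B 0 y" "B x (0 + 0) = B x 0 + B x 0"
    using assms unfolding bilinear_map_iff by blast+
  then show "B 0 y = 0" "B x 0 = 0" by simp_all
qed

text \<open>The vector space axioms need no separate clause: \<open>Vector_Spaces.linear\<close>,
  and hence \<open>bilinear_map\<close>, already contains them.\<close>

lemma leibniz_algebra_iff: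
  "leibniz_algebra s b \<longleftrightarrow> bilinear_map s s s b \<and>
    (\<forall>x y z. b x (b y z) = b (b x y) z - b (b x z) y)"
  unfolding leibniz_algebra_def leibniz_algebra_axioms_def bilinear_map_iff by blast

lemma vector_space_field: "vector_space ((*) :: 'k::field \<Rightarrow> 'k \<Rightarrow> 'k)"
  by unfold_locales (simp_all add: algebra_simps)

lemma vector_space_module_prod:
  assumes "vector_space s1" "vector_space s2"
  shows "vector_space (module_prod.scale s1 s2)"
proof -
  interpret vector_space_prod s1 s2
    using assms by (simp add: vector_space_prod_def vector_space_pair_def)
  show ?thesis by (rule p.vector_space_axioms)
qed

lemma module_prod_scale:
  assumes "vector_space s1" "vector_space s2"
  shows "module_prod.scale s1 s2 c (a, b) = (s1 c a, s2 c b)"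
proof -
  interpret vector_space_prod s1 s2
    using assms by (simp add: vector_space_prod_def vector_space_pair_def)
  show ?thesis by (rule scale_prod)
qed

lemma leibniz_algebra_transport:
  assumes b: "leibniz_algebra s1 b" and T: "Vector_Spaces.linear s1 s2 T" and "bij T"
  shows "leibniz_algebra s2 (transport_bracket T b)"
proof -
  have inv: "inv T (T u) = u" "T (inv T v) = v" for u v
    using \<open>bij T\<close> by (simp_all add: bij_is_inj bij_is_surj surj_f_inv_f)
  have T': "T (x + y) = T x + T y" "T (s1 c x) = s2 c (T x)" for x y c
    using T by (simp_all add: Vector_Spaces.linear_iff)
  have add: "inv T (x + y) = inv T x + inv T y" for x y
    by (metis T'(1) inv)
  have sc: "inv T (s2 c x) = s1 c (inv T x)" for x c
    by (metis T'(2) inv)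
  have diff: "T (x - y) = T x - T y" for x y
    by (metis T'(1) add_diff_cancel diff_add_cancel)
  have "vector_space s2" using T by (simp add: Vector_Spaces.linear_iff)
  moreover have "b (x + y) z = b x z + b y z" "b x (y + z) = b x y + b x z"
    "b (s1 c x) y = s1 c (b x y)" "b x (s1 c y) = s1 c (b x y)"
    "b x (b y z) = b (b x y) z - b (b x z) y" for x y z c
    using b unfolding leibniz_algebra_iff bilinear_map_iff by blast+
  ultimately show ?thesis
    unfolding leibniz_algebra_iff bilinear_map_iff transport_bracket_def
    by (simp add: inv(1) add sc T' diff)
qed

text \<open>Splitting each argument as \<open>(g, 0) + (0, x)\<close> cuts a bilinear
  \<open>B\<close> into four pieces. Their first components are the four maps of the crossed system,
  while the second component of \<open>B\<close> is prescribed by \<open>br\<close>.\<close>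

lemma crossed_system_of_bracket:
  fixes sg :: "'k::field \<Rightarrow> 'g::ab_group_add \<Rightarrow> 'g" and sL :: "'k \<Rightarrow> 'l::ab_group_add \<Rightarrow> 'l"
  assumes vs: "vector_space sg" "vector_space sL"
    and B: "leibniz_algebra (module_prod.scale sg sL) B"
    and snd: "\<And>u v. snd (B u v) = br (snd u) (snd v)"
  shows "\<exists>c \<in> crossed_systems sg sL br. crossed_bracket br c = B"
proof -
  define la ra f brg
    where "la = (\<lambda>g y. fst (B (g, 0) (0, y)))" and "ra = (\<lambda>x h. fst (B (0, x) (h, 0)))"
      and "f = (\<lambda>x y. fst (B (0, x) (0, y)))" and "brg = (\<lambda>g h. fst (B (g, 0) (h, 0)))"
  note defs = this
  interpret g: vector_space sg by fact
  interpret l: vector_space sL by fact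
  have bil: "bilinear_map (module_prod.scale sg sL) (module_prod.scale sg sL)
      (module_prod.scale sg sL) B"
    using B by (simp add: leibniz_algebra_iff)
  have B_add: "B (x + y) z = B x z + B y z" "B x (y + z) = B x y + B x z" for x y z
    using bil unfolding bilinear_map_iff by blast+
  have B_sc: "B (module_prod.scale sg sL c x) y = module_prod.scale sg sL c (B x y)"
    "B x (module_prod.scale sg sL c y) = module_prod.scale sg sL c (B x y)" for c x y
    using bil unfolding bilinear_map_iff by blast+
  have fst_sc: "fst (module_prod.scale sg sL c u) = sg c (fst u)" for c u
    by (metis module_prod_scale[OF vs] fst_conv surj_pair)
  have dec: "(g, x) = (g, 0) + (0, x)" for g :: 'g and x :: 'l by simp
  have exp: "B (g, x) (h, y) = (brg g h + ra x h + la g y + f x y, br x y)" for g x h y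
  proof (rule prod_eqI)
    have "B (g, x) (h, y) = B (g, 0) (h, 0) + B (g, 0) (0, y) + (B (0, x) (h, 0) + B (0, x) (0, y))"
      by (subst dec[of g x], subst dec[of h y], simp only: B_add add.assoc add.left_commute)
    then show "fst (B (g, x) (h, y)) = fst (brg g h + ra x h + la g y + f x y, br x y)"
      by (simp add: defs algebra_simps)
  qed (simp add: snd)
  \<comment> \<open>These equations turn sums and multiples inside one factor into sums and
    multiples in the product, where bilinearity of \<open>B\<close> applies.\<close>
  have left: "(g + g', 0) = (g, 0) + (g', 0 :: 'l)" for g g' :: 'g by simp
  have right: "(0, x + x') = (0 :: 'g, x) + (0, x')" for x x' :: 'l by simp
  have left_sc: "(sg c g, 0) = module_prod.scale sg sL c (g, 0)" for c g
    by (simp add: module_prod_scale[OF vs])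
  have right_sc: "(0, sL c x) = module_prod.scale sg sL c (0, x)" for c x
    by (simp add: module_prod_scale[OF vs])
  note lin = bilinear_map_iff defs left right left_sc right_sc B_add B_sc fst_sc fst_add
  have maps: "bilinear_map sg sL sg la" "bilinear_map sL sg sg ra"
    "bilinear_map sL sL sg f" "bilinear_map sg sg sg brg"
    using vs by (simp_all only: lin) simp_all
  have cb: "crossed_bracket br (la, ra, f, brg) = B"
    by (intro ext) (metis crossed_bracket.simps exp surj_pair)
  have "(la, ra, f, brg) \<in> crossed_systems sg sL br"
    using maps B unfolding crossed_systems_def cb[symmetric] by simp
  with cb show ?thesis by blast
qed

section \<open>Co-flag data as crossed systems by the field\<close>

context leibniz_algebra begin

section \<open>The equivalence relation on co-flag data\<close>

lemma equiv_coflag_rel: "equiv (coflag_data scale bracket) (coflag_rel scale bracket)"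
proof (rule equivI)
  note lin = Vector_Spaces.linear_iff vector_space_field vector_space_axioms
  show "coflag_rel scale bracket \<subseteq> coflag_data scale bracket \<times> coflag_data scale bracket"
    by (auto simp: coflag_rel_def)
  show "refl_on (coflag_data scale bracket) (coflag_rel scale bracket)"
    unfolding refl_on_def coflag_rel_def by (auto intro!: exI[of _ "\<lambda>_. 0"] simp: lin)
  have relE: "\<exists>lam Lam f f' r. d = (lam, Lam, f) \<and> d' = (lam, Lam, f') \<and>
      d \<in> coflag_data scale bracket \<and> d' \<in> coflag_data scale bracket \<and>
      Vector_Spaces.linear scale (*) r \<and>
      (\<forall>x y. f x y = f' x y - r (bracket x y) + Lam x * r y + r x * lam y)"
    if "(d, d') \<in> coflag_rel scale bracket" for d d' :: "('k, 'l) coflag"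
    using that by (cases d; cases d') (simp add: coflag_rel_def)
  show "sym (coflag_rel scale bracket)"
  proof (rule symI)
    fix d d' :: "('k, 'l) coflag"
    assume "(d, d') \<in> coflag_rel scale bracket"
    from relE[OF this] obtain lam Lam f f' r where
      d: "d = (lam, Lam, f)" "d' = (lam, Lam, f')"
        "d \<in> coflag_data scale bracket" "d' \<in> coflag_data scale bracket"
      and r: "Vector_Spaces.linear scale (*) r"
      and f: "\<forall>x y. f x y = f' x y - r (bracket x y) + Lam x * r y + r x * lam y"
      by blast
    \<comment> \<open>Related data share \<open>lam\<close> and \<open>Lam\<close>, so the
      correction term is linear in \<open>r\<close>. Hence reversal negates \<open>r\<close>, and
      transitivity below adds the two maps.\<close>
    have "Vector_Spaces.linear scale (*) (\<lambda>x. - r x) \<and>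
        (\<forall>x y. f' x y = f x y - (- r (bracket x y)) + Lam x * (- r y) + (- r x) * lam y)"
      using r f by (simp add: lin)
    then have "\<exists>r. Vector_Spaces.linear scale (*) r \<and>
        (\<forall>x y. f' x y = f x y - r (bracket x y) + Lam x * r y + r x * lam y)"
      by (rule exI[of _ "\<lambda>x. - r x"])
    with d show "(d', d) \<in> coflag_rel scale bracket"
      by (simp add: coflag_rel_def)
  qed
  show "trans (coflag_rel scale bracket)"
  proof (rule transI)
    fix d d' d'' :: "('k, 'l) coflag"
    assume "(d, d') \<in> coflag_rel scale bracket" and *: "(d', d'') \<in> coflag_rel scale bracket"
    from relE[OF this(1)] obtain lam Lam f f' r where
      d: "d = (lam, Lam, f)" "d' = (lam, Lam, f')" "d \<in> coflag_data scale bracket"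
      and r: "Vector_Spaces.linear scale (*) r"
      and f: "\<forall>x y. f x y = f' x y - r (bracket x y) + Lam x * r y + r x * lam y"
      by blast
    from relE[OF *] d obtain f'' r' where
      d'': "d'' = (lam, Lam, f'')" "d'' \<in> coflag_data scale bracket"
      and r': "Vector_Spaces.linear scale (*) r'"
      and f': "\<forall>x y. f' x y = f'' x y - r' (bracket x y) + Lam x * r' y + r' x * lam y"
      by blast
    have "Vector_Spaces.linear scale (*) (\<lambda>x. r x + r' x) \<and>
        (\<forall>x y. f x y = f'' x y - (r (bracket x y) + r' (bracket x y))
          + Lam x * (r y + r' y) + (r x + r' x) * lam y)"
      using r r' f f' by (simp add: lin algebra_simps)
    then have "\<exists>r. Vector_Spaces.linear scale (*) r \<and>
        (\<forall>x y. f x y = f'' x y - r (bracket x y) + Lam x * r y + r x * lam y)"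
      by (rule exI[of _ "\<lambda>x. r x + r' x"])
    with d d'' show "(d, d'') \<in> coflag_rel scale bracket"
      by (simp add: coflag_rel_def)
  qed
qed

text \<open>Each co-flag axiom is the Leibniz identity at a triple of vectors \<open>(0, x)\<close>
  with at most one entry replaced by \<open>(1, 0)\<close>. Conversely these axioms account for
  every term of the expanded identity.\<close>

lemma leibniz_coflag_bracket_iff:
  assumes lam: "Vector_Spaces.linear scale (*) lam" and Lam: "Vector_Spaces.linear scale (*) Lam"
    and f: "bilinear_map scale scale (*) f"
  shows "leibniz_algebra (module_prod.scale (*) scale) (coflag_bracket bracket (lam, Lam, f)) \<longleftrightarrow>
    (lam, Lam, f) \<in> coflag_data scale bracket"
    (is "leibniz_algebra ?s ?B \<longleftrightarrow> _")
proof
  note sc = module_prod_scale[OF vector_space_field vector_space_axioms]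
  note lin = lam[unfolded Vector_Spaces.linear_iff] Lam[unfolded Vector_Spaces.linear_iff] f[unfolded bilinear_map_iff]
  have z: "lam 0 = 0" "Lam 0 = 0"
    using lam Lam by (simp_all add: linear_map_zero)
  have zf: "f 0 x = 0" "f x 0 = 0" for x
    using bilinear_map_zero[OF f] by auto
  have zb: "bracket 0 x = 0" "bracket x 0 = 0" for x
    using bilinear_map_zero[OF bracket_bilinear] by auto
  {
    assume "leibniz_algebra ?s ?B"
    then have L: "?B u (?B v w) = ?B (?B u v) w - ?B (?B u w) v" for u v w
      unfolding leibniz_algebra_iff by blast
    \<comment> \<open>With \<open>(1, 0)\<close> in first position the right side is
      \<open>lam x * lam y - lam y * lam x\<close>, which is zero; in second position the products
      likewise cancel and leave \<open>Lam (bracket x y)\<close>.\<close>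
    have "lam (bracket x y) = 0" for x y
      using L[of "(1, 0)" "(0, x)" "(0, y)"] by (simp add: z zf zb)
    moreover have "Lam (bracket x y) = 0" for x y
      using L[of "(0, x)" "(1, 0)" "(0, y)"] by (simp add: z zf zb)
    \<comment> \<open>With \<open>(1, 0)\<close> in third position a term
      \<open>Lam (bracket x y)\<close> appears, which has just been shown to vanish.\<close>
    moreover have "Lam x * Lam y = - (Lam x * lam y)" for x y
      using L[of "(0, x)" "(0, y)" "(1, 0)"] \<open>Lam (bracket x y) = 0\<close>
      by (simp add: z zf zb mult.commute)
    moreover have "f (bracket x y) z - f (bracket x z) y - f x (bracket y z)
              = Lam x * f y z - lam z * f x y + lam y * f x z" for x y z
      using L[of "(0, x)" "(0, y)" "(0, z)"] by (simp add: z zf zb algebra_simps)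
    ultimately show "(lam, Lam, f) \<in> coflag_data scale bracket"
      using lam Lam f by (simp add: coflag_data_def)
  next
    assume "(lam, Lam, f) \<in> coflag_data scale bracket"
    then have d: "lam (bracket x y) = 0" "Lam (bracket x y) = 0"
        "Lam x * Lam y = - (Lam x * lam y)"
        "f (bracket x y) z = f (bracket x z) y + f x (bracket y z)
              + Lam x * f y z - lam z * f x y + lam y * f x z" for x y z
      by (auto simp: coflag_data_def algebra_simps)
    have br: "bracket (x + y) z = bracket x z + bracket y z"
      "bracket x (y + z) = bracket x y + bracket x z"
      "bracket (scale c x) y = scale c (bracket x y)"
      "bracket x (scale c y) = scale c (bracket x y)" for x y z c
      using bracket_bilinear unfolding bilinear_map_iff by blast+
    have "bilinear_map ?s ?s ?s ?B"
      unfolding bilinear_map_iff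
      using lin by (auto simp: vector_space_module_prod vector_space_field vector_space_axioms sc br
          algebra_simps)
    moreover have "?B u (?B v w) = ?B (?B u v) w - ?B (?B u w) v" for u v w
    proof -
      obtain a x b y c z where [simp]: "u = (a, x)" "v = (b, y)" "w = (c, z)"
        by (metis surj_pair)
      \<comment> \<open>The terms in \<open>a\<close> and \<open>b\<close> cancel by commutativity
        and vanishing on brackets. Those in \<open>c\<close> need this multiple of the product
        axiom, and what remains is the identity for \<open>f\<close>.\<close>
      have "c * (Lam x * Lam y) = - (c * (Lam x * lam y))" by (simp add: d(3))
      then show ?thesis using leibniz[of x y z] d(4)[of x y z]
        by (simp add: d(1,2) algebra_simps)
    qed
    ultimately show "leibniz_algebra ?s ?B"
      unfolding leibniz_algebra_iff by blast
  }
qed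

section \<open>Correspondence between co-flag data and crossed systems by the field\<close>

definition coflag_crossed :: "('k, 'l) coflag \<Rightarrow> ('k, 'l) crossed"
  where "coflag_crossed =
    (\<lambda>(lam, Lam, f). (\<lambda>g x. g * lam x, \<lambda>x g. Lam x * g, f, \<lambda>_ _. 0))"

lemma crossed_bracket_coflag_crossed:
  "crossed_bracket bracket (coflag_crossed d) = coflag_bracket bracket d"
proof (intro ext)
  fix u v
  show "crossed_bracket bracket (coflag_crossed d) u v = coflag_bracket bracket d u v"
    by (cases d; cases u; cases v) (simp add: coflag_crossed_def algebra_simps)
qed

lemma coflag_data_linear:
  assumes "(lam, Lam, f) \<in> coflag_data scale bracket"
  shows "Vector_Spaces.linear scale (*) lam" "Vector_Spaces.linear scale (*) Lam"
    "bilinear_map scale scale (*) f"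
  using assms by (simp_all add: coflag_data_def)

lemma leibniz_coflag_bracket:
  assumes "d \<in> coflag_data scale bracket"
  shows "leibniz_algebra (module_prod.scale (*) scale) (coflag_bracket bracket d)"
  using assms leibniz_coflag_bracket_iff coflag_data_linear by (metis prod_cases3)

lemma coflag_crossed_in_crossed_systems:
  assumes "d \<in> coflag_data scale bracket"
  shows "coflag_crossed d \<in> crossed_systems (*) scale bracket"
proof -
  obtain lam Lam f where d: "d = (lam, Lam, f)" by (metis prod_cases3)
  note lin = coflag_data_linear[OF assms[unfolded d]]
  have "leibniz_algebra (module_prod.scale (*) scale) (crossed_bracket bracket (coflag_crossed d))"
    using leibniz_coflag_bracket[OF assms] by (simp add: crossed_bracket_coflag_crossed)
  moreover have "bilinear_map (*) scale (*) (\<lambda>g x. g * lam x)"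
      "bilinear_map scale (*) (*) (\<lambda>x g. Lam x * g)" "bilinear_map (*) (*) (*) (\<lambda>_ _. 0 :: 'k)"
    using lin by (simp_all add: bilinear_map_iff Vector_Spaces.linear_iff algebra_simps)
  ultimately show ?thesis
    using lin(3) unfolding d crossed_systems_def by (simp add: coflag_crossed_def)
qed

lemma crossed_system_eq_coflag_crossed:
  assumes "c \<in> crossed_systems (*) scale bracket"
  shows "\<exists>d \<in> coflag_data scale bracket. c = coflag_crossed d"
proof -
  obtain la ra f brg where c: "c = (la, ra, f, brg)" by (metis prod_cases4)
  have la: "bilinear_map (*) scale (*) la" and ra: "bilinear_map scale (*) (*) ra"
    and f: "bilinear_map scale scale (*) f" and brg: "bilinear_map (*) (*) (*) brg"
    and L: "leibniz_algebra (module_prod.scale (*) scale) (crossed_bracket bracket c)"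
    using assms by (auto simp: c crossed_systems_def)
  \<comment> \<open>A linear map out of the field is determined by its value at 1, so each bilinear
    map reduces to its values with field arguments equal to 1.\<close>
  have la1: "la g x = g * la 1 x" for g x
    using la unfolding bilinear_map_iff by (metis mult.right_neutral)
  have ra1: "ra x g = ra x 1 * g" for g x
    using ra unfolding bilinear_map_iff by (metis mult.right_neutral mult.commute)
  have brg1: "brg g h = g * h * brg 1 1" for g h
    using brg unfolding bilinear_map_iff by (metis mult.right_neutral mult.assoc mult.commute)
  have zero: "la x 0 = 0" "ra 0 x = 0" "f 0 y = 0" "bracket 0 y = 0" for x y
    using la ra f bracket_bilinear bilinear_map_zero by blast+
  \<comment> \<open>For three equal arguments the right side of the Leibniz identity is a difference
    of equal terms. The first component of the left side is the square of
    \<open>brg 1 1\<close>.\<close>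
  have "crossed_bracket bracket c (1, 0) (crossed_bracket bracket c (1, 0) (1, 0)) = 0"
    using L unfolding leibniz_algebra_iff by simp
  then have "brg 1 (brg 1 1) = 0" by (simp add: c zero zero_prod_def)
  then have "brg 1 1 = 0" using brg1[of 1 "brg 1 1"] by simp
  then have brg0: "brg g h = 0" for g h using brg1[of g h] by simp
  define d where "d = (la 1, \<lambda>x. ra x 1, f)"
  have cd: "c = coflag_crossed d"
    unfolding c d_def coflag_crossed_def by (auto simp: fun_eq_iff brg0 la1[symmetric] ra1[symmetric])
  have "leibniz_algebra (module_prod.scale (*) scale) (coflag_bracket bracket d)"
    using L by (simp add: cd crossed_bracket_coflag_crossed)
  then have "d \<in> coflag_data scale bracket"
    using leibniz_coflag_bracket_iff la ra f unfolding d_def by (simp add: bilinear_map_def)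
  with cd show ?thesis by blast
qed

lemma inj_coflag_crossed: "inj coflag_crossed"
proof (rule injI)
  fix d d' :: "('k, 'l) coflag"
  assume "coflag_crossed d = coflag_crossed d'"
  then have "\<forall>g x. g * fst d x = g * fst d' x" "\<forall>x g. fst (snd d) x * g = fst (snd d') x * g"
      "snd (snd d) = snd (snd d')"
    by (simp_all add: coflag_crossed_def case_prod_beta fun_eq_iff)
  then show "d = d'"
    by (simp add: prod_eq_iff fun_eq_iff) (metis mult_1 mult_1_right)
qed

lemma bij_betw_coflag_crossed:
  "bij_betw coflag_crossed (coflag_data scale bracket) (crossed_systems (*) scale bracket)"
  unfolding bij_betw_def
  using inj_coflag_crossed crossed_system_eq_coflag_crossed coflag_crossed_in_crossed_systems
  by (blast intro: inj_on_subset)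

text \<open>The bracket on the field is zero, so \<open>r\<close> drops out of the conditions on the
  two actions. Evaluating these at the scalar 1 gives equality of the linear forms, and the
  condition on \<open>f\<close> is the one for co-flag data.\<close>

lemma cohomologous_coflag_crossed_iff:
  assumes "d \<in> coflag_data scale bracket" "d' \<in> coflag_data scale bracket"
  shows "(coflag_crossed d, coflag_crossed d') \<in> cohomologous (*) scale bracket \<longleftrightarrow>
    (d, d') \<in> coflag_rel scale bracket"
proof -
  obtain lam Lam f where d: "d = (lam, Lam, f)" by (metis prod_cases3)
  obtain lam' Lam' f' where d': "d' = (lam', Lam', f')" by (metis prod_cases3)
  have "lam = lam'" if "\<forall>g x. g * lam x = g * lam' x"
    using that[rule_format, of 1] by (simp add: fun_eq_iff)
  moreover have "Lam = Lam'" if "\<forall>x g. Lam x * g = Lam' x * g"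
    using that[rule_format, of _ 1] by (simp add: fun_eq_iff)
  ultimately show ?thesis
    using assms coflag_crossed_in_crossed_systems[OF assms(1)]
      coflag_crossed_in_crossed_systems[OF assms(2)]
    unfolding d d' cohomologous_def coflag_rel_def coflag_crossed_def by auto
qed

text \<open>The right side says that the shear \<open>(a, x) \<mapsto> (a + r x, x)\<close> respects
  the brackets. This is the form in which isomorphisms of extensions are compared with the relation
  on data.\<close>

lemma coflag_rel_iff_shear:
  assumes "d \<in> coflag_data scale bracket" "d' \<in> coflag_data scale bracket"
  shows "(d, d') \<in> coflag_rel scale bracket \<longleftrightarrow>
    (\<exists>r. Vector_Spaces.linear scale (*) r \<and> (\<forall>a x b y.
      (fst (coflag_bracket bracket d (a, x) (b, y)) + r (bracket x y), bracket x y) =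
      coflag_bracket bracket d' (a + r x, x) (b + r y, y)))"
proof -
  obtain lam Lam f where d: "d = (lam, Lam, f)" by (metis prod_cases3)
  obtain lam' Lam' f' where d': "d' = (lam', Lam', f')" by (metis prod_cases3)
  note lin = coflag_data_linear[OF assms(1)[unfolded d]] coflag_data_linear[OF assms(2)[unfolded d']]
  have z: "lam 0 = 0" "Lam 0 = 0" "lam' 0 = 0" "Lam' 0 = 0"
    using lin by (simp_all add: linear_map_zero)
  have zf: "f 0 x = 0" "f x 0 = 0" "f' 0 x = 0" "f' x 0 = 0" for x
    using bilinear_map_zero[OF lin(3)] bilinear_map_zero[OF lin(6)] by auto
  have zb: "bracket 0 x = 0" "bracket x 0 = 0" for x
    using bilinear_map_zero[OF bracket_bilinear] by auto
  have "(lam = lam' \<and> Lam = Lam' \<and>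
      (\<forall>x y. f x y = f' x y - r (bracket x y) + Lam x * r y + r x * lam y)) \<longleftrightarrow>
    (\<forall>a x b y. a * lam y + b * Lam x + f x y + r (bracket x y) =
      (a + r x) * lam' y + (b + r y) * Lam' x + f' x y)" (is "?l \<longleftrightarrow> ?r")
    if "Vector_Spaces.linear scale (*) r" for r
  proof
    have r0: "r 0 = 0" using that by (rule linear_map_zero)
    show ?l if ?r
    proof -
      \<comment> \<open>Taking \<open>a = 1\<close>, \<open>b = 0\<close>, \<open>x = 0\<close>
        isolates \<open>lam\<close>; taking \<open>a = 0\<close>, \<open>b = 1\<close>,
        \<open>y = 0\<close> isolates \<open>Lam\<close>; taking \<open>a = b = 0\<close> then
        leaves the condition on \<open>f\<close>.\<close>
      have lam: "lam = lam'"
        using \<open>?r\<close>[rule_format, of 1 _ 0 0] by (simp add: fun_eq_iff z zf zb r0)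
      have Lam: "Lam = Lam'"
        using \<open>?r\<close>[rule_format, of 0 0 1] by (simp add: fun_eq_iff z zf zb r0)
      show ?l
        using \<open>?r\<close>[rule_format, of 0 _ 0] lam Lam by (simp add: algebra_simps)
    qed
  qed (simp add: algebra_simps)
  then have "(lam = lam' \<and> Lam = Lam' \<and> (\<exists>r. Vector_Spaces.linear scale (*) r \<and>
      (\<forall>x y. f x y = f' x y - r (bracket x y) + Lam x * r y + r x * lam y))) \<longleftrightarrow>
    (\<exists>r. Vector_Spaces.linear scale (*) r \<and> (\<forall>a x b y.
      a * lam y + b * Lam x + f x y + r (bracket x y) =
      (a + r x) * lam' y + (b + r y) * Lam' x + f' x y))" by blast
  then show ?thesis
    using assms unfolding d d' coflag_rel_def by simp
qed

end

section \<open>Extensions with a chosen section\<close>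

lemma linear_inv_bij:
  assumes "Vector_Spaces.linear s1 s2 T" "bij T"
  shows "Vector_Spaces.linear s2 s1 (inv T)"
proof -
  have inv: "inv T (T u) = u" "T (inv T v) = v" for u v
    using \<open>bij T\<close> by (simp_all add: bij_is_inj bij_is_surj surj_f_inv_f)
  show ?thesis
    using assms(1) unfolding Vector_Spaces.linear_iff by (metis inv)
qed

text \<open>Surjectivity of \<open>p\<close> is recorded by a linear section \<open>s\<close>, and
  one-dimensionality of the kernel by a nonzero generator \<open>g0\<close>, so that explicit
  coordinates on \<open>E\<close> are available.\<close>

locale split_extension = leibniz_algebra scale bracket
  for scale :: "'k::field \<Rightarrow> 'l::ab_group_add \<Rightarrow> 'l" and bracket :: "'l \<Rightarrow> 'l \<Rightarrow> 'l" +
  fixes sE :: "'k \<Rightarrow> 'e::ab_group_add \<Rightarrow> 'e" and p :: "'e \<Rightarrow> 'l" and g0 :: 'e and s :: "'l \<Rightarrow> 'e"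
  assumes linear_p: "Vector_Spaces.linear sE scale p"
    and linear_s: "Vector_Spaces.linear scale sE s"
    and p_s: "p (s x) = x"
    and g0_nonzero: "g0 \<noteq> 0"
    and ker_p: "p v = 0 \<longleftrightarrow> (\<exists>a. v = sE a g0)"
begin

section \<open>Coordinates on \<open>E\<close> determined by the section\<close>

abbreviation T :: "'k \<times> 'l \<Rightarrow> 'e" where "T \<equiv> splitting sE g0 s"

sublocale ext: vector_space sE
  using linear_p by (simp add: Vector_Spaces.linear_iff)

lemma linear_splitting: "Vector_Spaces.linear (module_prod.scale (*) scale) sE T"
  using linear_s
  by (auto simp: Vector_Spaces.linear_iff splitting_def vector_space_module_prod vector_space_field
      vector_space_axioms module_prod_scale algebra_simps ext.scale_right_distrib
      ext.scale_left_distrib)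

lemma p_add_kernel: "p (sE a g0 + v) = p v"
  using linear_p ker_p[of "sE a g0"] by (auto simp: Vector_Spaces.linear_iff)

lemma p_splitting: "p (T u) = snd u"
  by (simp add: splitting_def case_prod_beta p_add_kernel p_s)

lemma p_eqD:
  assumes "p v = p w"
  shows "\<exists>a. v = sE a g0 + w"
proof -
  have "p (v - w) + p w = p v"
    using linear_p unfolding Vector_Spaces.linear_iff by (metis diff_add_cancel)
  then have "p (v - w) = 0" using assms by simp
  then show ?thesis unfolding ker_p by (metis diff_add_cancel)
qed

text \<open>Applying \<open>p\<close> recovers \<open>x\<close>, and then the scalar is determined
  because \<open>g0\<close> is nonzero. For surjectivity, \<open>v\<close> and
  \<open>s (p v)\<close> have the same image under \<open>p\<close> and so differ by a multiple of
  \<open>g0\<close>.\<close>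

lemma bij_splitting: "bij T"
proof (rule bijI)
  show "inj T"
  proof (rule injI)
    fix u v assume eq: "T u = T v"
    then have snd: "snd u = snd v" by (metis p_splitting)
    with eq have "sE (fst u) g0 = sE (fst v) g0"
      by (simp add: splitting_def case_prod_beta)
    with snd show "u = v" using g0_nonzero by (simp add: prod_eq_iff)
  qed
  show "surj T"
  proof (rule surjI)
    fix v
    show "T (SOME u. T u = v) = v"
    proof (rule someI_ex)
      obtain a where "v = sE a g0 + s (p v)" using p_eqD[of v "s (p v)"] p_s by auto
      then have "T (a, p v) = v" by (simp add: splitting_def)
      then show "\<exists>u. T u = v" by blast
    qed
  qed
qed

lemma inv_splitting [simp]: "inv T (T u) = u" "T (inv T v) = v"
  using bij_splitting by (simp_all add: bij_is_inj bij_is_surj surj_f_inv_f)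

lemma snd_inv_splitting: "snd (inv T v) = p v"
  by (metis inv_splitting(2) p_splitting)

lemma coflag_structure_splitting:
  "coflag_structure sE bracket g0 s d (T u) (T v) = T (coflag_bracket bracket d u v)"
  by (simp add: coflag_structure_def transport_bracket_def)

lemma snd_coflag_bracket: "snd (coflag_bracket bracket d u v) = bracket (snd u) (snd v)"
  by (cases d; cases u; cases v) simp

section \<open>Extension structures and their isomorphisms in coordinates\<close>

lemma coflag_structure_in_ext_structures:
  assumes "d \<in> coflag_data scale bracket"
  shows "coflag_structure sE bracket g0 s d \<in> ext_structures sE scale bracket p"
proof -
  have "leibniz_algebra sE (coflag_structure sE bracket g0 s d)"
    unfolding coflag_structure_def
    using leibniz_algebra_transport leibniz_coflag_bracket[OF assms] linear_splitting bij_splitting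
    by blast
  moreover have "p (coflag_structure sE bracket g0 s d x y) = bracket (p x) (p y)" for x y
    by (simp add: coflag_structure_def transport_bracket_def p_splitting snd_coflag_bracket
        snd_inv_splitting)
  ultimately show ?thesis
    using linear_p by (simp add: ext_structures_def leibniz_hom_def)
qed

text \<open>Pulled back along \<open>T\<close>, the bracket lives on the product and covers
  \<open>bracket\<close>. It therefore comes from a crossed system by the field, which in turn comes
  from a co-flag datum.\<close>

lemma ext_structure_eq_coflag_structure:
  assumes "b \<in> ext_structures sE scale bracket p"
  shows "\<exists>d \<in> coflag_data scale bracket. b = coflag_structure sE bracket g0 s d"
proof -
  define B where "B = transport_bracket (inv T) b"
  have L: "leibniz_algebra sE b" and hom: "p (b x y) = bracket (p x) (p y)" for x y
    using assms by (simp_all add: ext_structures_def leibniz_hom_def)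
  have B: "B u v = inv T (b (T u) (T v))" for u v
    by (simp add: B_def transport_bracket_def inv_inv_eq bij_splitting)
  have "leibniz_algebra (module_prod.scale (*) scale) B"
    unfolding B_def
    by (rule leibniz_algebra_transport[OF L linear_inv_bij[OF linear_splitting bij_splitting]
          bij_imp_bij_inv[OF bij_splitting]])
  moreover have "snd (B u v) = bracket (snd u) (snd v)" for u v
    by (simp add: B snd_inv_splitting hom p_splitting)
  ultimately obtain c where "c \<in> crossed_systems (*) scale bracket" "crossed_bracket bracket c = B"
    using crossed_system_of_bracket[OF vector_space_field vector_space_axioms, of B bracket] by blast
  then obtain d where d: "d \<in> coflag_data scale bracket" "coflag_bracket bracket d = B"
    using crossed_system_eq_coflag_crossed crossed_bracket_coflag_crossed by metis
  have "b = coflag_structure sE bracket g0 s d"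
    by (intro ext) (simp add: coflag_structure_def transport_bracket_def d B)
  with d show ?thesis by blast
qed

lemma ext_rel_coflag_structure_iff:
  assumes d: "d \<in> coflag_data scale bracket" "d' \<in> coflag_data scale bracket"
  shows "(coflag_structure sE bracket g0 s d, coflag_structure sE bracket g0 s d')
      \<in> ext_rel sE scale bracket p \<longleftrightarrow> (d, d') \<in> coflag_rel scale bracket"
    (is "(?b, ?b') \<in> _ \<longleftrightarrow> _")
proof
  assume "(?b, ?b') \<in> ext_rel sE scale bracket p"
  then obtain \<phi> where lin: "Vector_Spaces.linear sE sE \<phi>" and hom: "\<And>x y. \<phi> (?b x y) = ?b' (\<phi> x) (\<phi> y)"
    and ker: "\<And>v. p v = 0 \<Longrightarrow> \<phi> v = v" and p\<phi>: "\<And>v. p (\<phi> v) = p v"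
    unfolding ext_rel_def leibniz_iso_def leibniz_hom_def by (auto simp: fun_eq_iff)
  \<comment> \<open>Since \<open>\<phi>\<close> preserves \<open>p\<close>, the vector
    \<open>\<phi> (s x)\<close> has second coordinate \<open>x\<close>; \<open>r x\<close> is its
    kernel coordinate. As \<open>\<phi>\<close> also fixes the kernel, it is the shear by
    \<open>r\<close>.\<close>
  define r where "r = (\<lambda>x. fst (inv T (\<phi> (s x))))"
  have \<phi>s: "\<phi> (s x) = T (r x, x)" for x
    by (metis r_def inv_splitting(2) p\<phi> p_s p_splitting prod.collapse)
  have \<phi>T: "\<phi> (T (a, x)) = T (a + r x, x)" for a x
  proof -
    have "\<phi> (sE a g0) = sE a g0" using ker ker_p by blast
    moreover have "\<phi> (v + w) = \<phi> v + \<phi> w" for v w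
      using lin by (simp add: Vector_Spaces.linear_iff)
    ultimately have "\<phi> (T (a, x)) = sE a g0 + \<phi> (s x)"
      by (simp add: splitting_def)
    also have "\<dots> = T (a + r x, x)"
      unfolding \<phi>s by (simp add: splitting_def ext.scale_left_distrib)
    finally show ?thesis .
  qed
  have "Vector_Spaces.linear sE (module_prod.scale (*) scale) (inv T)"
    using linear_inv_bij[OF linear_splitting bij_splitting] .
  then have "Vector_Spaces.linear scale (*) r"
    using lin linear_s
    by (simp add: r_def Vector_Spaces.linear_iff vector_space_field)
      (metis fst_conv module_prod_scale surj_pair vector_space_field vector_space_axioms)
  moreover have "(fst (coflag_bracket bracket d (a, x) (b, y)) + r (bracket x y), bracket x y) =
      coflag_bracket bracket d' (a + r x, x) (b + r y, y)" for a x b y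
  proof -
    let ?c = "coflag_bracket bracket d (a, x) (b, y)"
    have "?c = (fst ?c, bracket x y)" by (metis snd_coflag_bracket prod.collapse snd_conv)
    then have "T (fst ?c + r (bracket x y), bracket x y) = \<phi> (T ?c)" by (metis \<phi>T)
    also have "\<dots> = T (coflag_bracket bracket d' (a + r x, x) (b + r y, y))"
      by (simp add: hom \<phi>T flip: coflag_structure_splitting)
    finally show ?thesis by (metis inv_splitting(1))
  qed
  ultimately show "(d, d') \<in> coflag_rel scale bracket"
    using coflag_rel_iff_shear[OF d] by blast
next
  assume "(d, d') \<in> coflag_rel scale bracket"
  then obtain r where r: "Vector_Spaces.linear scale (*) r"
    and shear: "\<And>a x b y. (fst (coflag_bracket bracket d (a, x) (b, y)) + r (bracket x y), bracket x y)
      = coflag_bracket bracket d' (a + r x, x) (b + r y, y)"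
    using coflag_rel_iff_shear[OF d] by blast
  \<comment> \<open>This is the shear by \<open>r\<close>, written without coordinates.\<close>
  define \<phi> where "\<phi> = (\<lambda>v. sE (r (p v)) g0 + v)"
  have p\<phi>: "p (\<phi> v) = p v" for v by (simp add: \<phi>_def p_add_kernel)
  have \<phi>T: "\<phi> (T (a, x)) = T (a + r x, x)" for a x
    by (simp add: \<phi>_def p_splitting) (simp add: splitting_def ext.scale_left_distrib)
  have "\<phi> (?b u v) = ?b' (\<phi> u) (\<phi> v)" for u v
  proof -
    obtain a x b y where uv: "u = T (a, x)" "v = T (b, y)"
      by (metis inv_splitting(2) surj_pair)
    let ?c = "coflag_bracket bracket d (a, x) (b, y)"
    have "?c = (fst ?c, bracket x y)" by (metis snd_coflag_bracket prod.collapse snd_conv)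
    then have "\<phi> (T ?c) = T (fst ?c + r (bracket x y), bracket x y)" by (metis \<phi>T)
    then show ?thesis
      unfolding uv \<phi>T coflag_structure_splitting shear .
  qed
  moreover have "Vector_Spaces.linear sE sE \<phi>"
    using linear_p r
    by (simp add: \<phi>_def Vector_Spaces.linear_iff ext.scale_left_distrib ext.scale_right_distrib)
  moreover have "p (v - sE a g0) = p v" for a v
    using p_add_kernel[of "- a" v] by simp
  \<comment> \<open>Adding or subtracting a kernel vector leaves \<open>p v\<close> unchanged, so
    subtracting the same multiple of \<open>g0\<close> inverts \<open>\<phi>\<close>.\<close>
  then have "bij \<phi>"
    by (intro o_bij[of "\<lambda>v. v - sE (r (p v)) g0"])
      (simp_all add: fun_eq_iff p_add_kernel \<phi>_def)
  moreover have "\<phi> v = v" if "p v = 0" for v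
    using that linear_map_zero[OF r] by (simp add: \<phi>_def)
  moreover have "p \<circ> \<phi> = p" using p\<phi> by (simp add: fun_eq_iff)
  ultimately show "(?b, ?b') \<in> ext_rel sE scale bracket p"
    using coflag_structure_in_ext_structures d
    unfolding ext_rel_def leibniz_iso_def leibniz_hom_def by blast
qed

lemma bij_betw_coflag_structure:
  "bij_betw (coflag_structure sE bracket g0 s)
    (coflag_data scale bracket) (ext_structures sE scale bracket p)"
proof -
  have "d = d'" if d: "d \<in> coflag_data scale bracket" "d' \<in> coflag_data scale bracket"
    and eq: "coflag_structure sE bracket g0 s d = coflag_structure sE bracket g0 s d'" for d d'
  proof -
    obtain lam Lam f where 1: "d = (lam, Lam, f)" by (metis prod_cases3)
    obtain lam' Lam' f' where 2: "d' = (lam', Lam', f')" by (metis prod_cases3)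
    note lin = coflag_data_linear[OF d(1)[unfolded 1]] coflag_data_linear[OF d(2)[unfolded 2]]
    have "coflag_bracket bracket d u v = coflag_bracket bracket d' u v" for u v
      using coflag_structure_splitting[of _ u v] eq by (metis inv_splitting(1))
    then have *: "a * lam y + b * Lam x + f x y = a * lam' y + b * Lam' x + f' x y" for a x b y
      unfolding 1 2 by (metis coflag_bracket.simps fst_conv)
    \<comment> \<open>Setting both scalars to 0 recovers \<open>f\<close>; setting one of them to 1
      then recovers \<open>lam\<close> or \<open>Lam\<close>.\<close>
    have "f x y = f' x y" for x y using *[of 0 y 0 x] by simp
    moreover have "lam y = lam' y" "Lam x = Lam' x" for x y
      using *[of 1 y 0 x] *[of 0 y 1 x] \<open>\<And>x y. f x y = f' x y\<close> by simp_all
    ultimately show ?thesis by (simp add: 1 2 fun_eq_iff)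
  qed
  then show ?thesis
    unfolding bij_betw_def inj_on_def
    using coflag_structure_in_ext_structures ext_structure_eq_coflag_structure by blast
qed

lemma ext_rel_subset:
  "ext_rel sE scale bracket p
    \<subseteq> ext_structures sE scale bracket p \<times> ext_structures sE scale bracket p"
  by (auto simp: ext_rel_def)

lemma equiv_ext_rel: "equiv (ext_structures sE scale bracket p) (ext_rel sE scale bracket p)"
  using equiv_bij_betw[OF equiv_coflag_rel bij_betw_coflag_structure ext_rel_subset
      ext_rel_coflag_structure_iff] .

end

text \<open>The change of coordinates \<open>s'.T \<circ> inv s.T\<close> intertwines the two
  transported brackets. It fixes the kernel because both coordinate maps send \<open>(a, 0)\<close>
  to the same multiple of \<open>g0\<close>.\<close>

lemma coflag_structure_section_independent:
  assumes s: "split_extension sL br sE p g0 s"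
    and s': "split_extension sL br sE p g0 s'"
    and d: "d \<in> coflag_data sL br"
  shows "(coflag_structure sE br g0 s d, coflag_structure sE br g0 s' d)
    \<in> ext_rel sE sL br p"
proof -
  interpret s: split_extension sL br sE p g0 s by fact
  interpret s': split_extension sL br sE p g0 s' by fact
  define \<phi> where "\<phi> = s'.T \<circ> inv s.T"
  let ?b = "coflag_structure sE br g0 s d" and ?b' = "coflag_structure sE br g0 s' d"
  have "\<phi> (?b x y) = ?b' (\<phi> x) (\<phi> y)" for x y
    by (simp add: \<phi>_def s'.coflag_structure_splitting)
      (simp add: coflag_structure_def transport_bracket_def)
  moreover have "Vector_Spaces.linear sE sE \<phi>"
    unfolding \<phi>_def
    using Vector_Spaces.linear_compose linear_inv_bij s.linear_splitting s.bij_splitting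
      s'.linear_splitting by blast
  moreover have "bij \<phi>"
    unfolding \<phi>_def using s.bij_splitting s'.bij_splitting by (simp add: bij_comp bij_imp_bij_inv)
  moreover have "\<phi> v = v" if ker: "p v = 0" for v
  proof -
    obtain a where v: "v = sE a g0" using ker s.ker_p by blast
    have "s.T (a, 0) = v" "s'.T (a, 0) = v"
      using linear_map_zero[OF s.linear_s] linear_map_zero[OF s'.linear_s]
      by (simp_all add: splitting_def v)
    then show ?thesis unfolding \<phi>_def by (metis comp_apply s.inv_splitting(1))
  qed
  moreover have "p \<circ> \<phi> = p"
    by (simp add: fun_eq_iff \<phi>_def s'.p_splitting s.snd_inv_splitting)
  ultimately show ?thesis
    using s.coflag_structure_in_ext_structures[OF d] s'.coflag_structure_in_ext_structures[OF d]
    unfolding ext_rel_def leibniz_iso_def leibniz_hom_def by blast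
qed

section \<open>Assembly of the bijections between the three quotients\<close>

theorem theorem3p4:
  fixes sL :: "'k::field \<Rightarrow> 'l::ab_group_add \<Rightarrow> 'l"
    and br :: "'l \<Rightarrow> 'l \<Rightarrow> 'l"
    and sE :: "'k \<Rightarrow> 'e::ab_group_add \<Rightarrow> 'e"
    and p :: "'e \<Rightarrow> 'l"
    and g0 :: 'e
  assumes "leibniz_algebra sL br"
    and "vector_space sE"
    and "Vector_Spaces.linear sE sL p"
    and "surj p"
    and "vector_space.dim sE {v. p v = 0} = 1"
    and "\<not> module.dependent sE {g0}"
    and "module.span sE {g0} = {v. p v = 0}"
  shows "equiv (ext_structures sE sL br p) (ext_rel sE sL br p) \<and>
    equiv (crossed_systems (*) sL br) (cohomologous (*) sL br) \<and>
    equiv (coflag_data sL br) (coflag_rel sL br) \<and>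
    (\<exists>\<Phi> \<Theta>.
      bij_betw \<Phi> (coflag_data sL br // coflag_rel sL br) (GHL2 (*) sL br) \<and>
      bij_betw \<Theta> (GHL2 (*) sL br) (Gext sE sL br p) \<and>
      (\<forall>d \<in> coflag_data sL br. \<forall>s. Vector_Spaces.linear sL sE s \<and> p \<circ> s = id \<longrightarrow>
        \<Theta> (\<Phi> (coflag_rel sL br `` {d})) =
          ext_rel sE sL br p `` {coflag_structure sE br g0 s d}))"
proof -
  let ?CF = "coflag_data sL br" and ?R = "coflag_rel sL br"
  let ?S = "ext_rel sE sL br p" and ?C = "cohomologous (*) sL br"
  interpret L: leibniz_algebra sL br by fact
  interpret E: vector_space sE by fact
  interpret EL: vector_space_pair sE sL ..
  have ker: "p v = 0 \<longleftrightarrow> (\<exists>a. v = sE a g0)" for v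
    using assms(7) unfolding E.span_singleton by blast
  have "g0 \<noteq> 0" using assms(6) by simp
  have split: "split_extension sL br sE p g0 s" if "Vector_Spaces.linear sL sE s" "p \<circ> s = id" for s
    using that assms(3) ker \<open>g0 \<noteq> 0\<close>
      L.leibniz_algebra_axioms
    by (simp add: split_extension_def split_extension_axioms_def fun_eq_iff)
  \<comment> \<open>The bijections are built from one section; the formula for all other sections
    follows from independence of the class.\<close>
  obtain s where "Vector_Spaces.linear sL sE s" "p \<circ> s = id"
    using EL.linear_surjective_right_inverse[OF assms(3,4)] by blast
  then interpret s: split_extension sL br sE p g0 s by (rule split)
  let ?c = "L.coflag_crossed" and ?e = "coflag_structure sE br g0 s"
  have C: "?C \<subseteq> crossed_systems (*) sL br \<times> crossed_systems (*) sL br"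
    by (auto simp: cohomologous_def)
  note transfer_c = L.equiv_coflag_rel L.bij_betw_coflag_crossed C L.cohomologous_coflag_crossed_iff
  note transfer_e = L.equiv_coflag_rel s.bij_betw_coflag_structure s.ext_rel_subset
    s.ext_rel_coflag_structure_iff
  define \<Phi> where "\<Phi> = (`) ?c"
  \<comment> \<open>Going back to co-flag classes first makes \<open>\<Theta> \<circ> \<Phi>\<close>
    the classwise image under \<open>?e\<close> on those classes.\<close>
  define \<Theta> where "\<Theta> = (`) ?e \<circ> inv_into (?CF // ?R) \<Phi>"
  have \<Phi>: "bij_betw \<Phi> (?CF // ?R) (GHL2 (*) sL br)"
    unfolding \<Phi>_def GHL2_def by (rule bij_betw_image_quotient[OF transfer_c])
  have \<Theta>: "bij_betw \<Theta> (GHL2 (*) sL br) (Gext sE sL br p)"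
    unfolding \<Theta>_def
    by (rule bij_betw_trans[OF bij_betw_inv_into[OF \<Phi>]])
      (unfold Gext_def, rule bij_betw_image_quotient[OF transfer_e])
  have "\<Theta> (\<Phi> (?R `` {d})) = ?S `` {coflag_structure sE br g0 s' d}"
    if d: "d \<in> ?CF" and s': "Vector_Spaces.linear sL sE s'" "p \<circ> s' = id" for d s'
  proof -
    have "\<Theta> (\<Phi> (?R `` {d})) = ?e ` (?R `` {d})"
      unfolding \<Theta>_def using bij_betw_inv_into_left[OF \<Phi> quotientI[OF d]] by simp
    also have "\<dots> = ?S `` {?e d}"
      by (rule bij_betw_image_class[OF transfer_e d])
    \<comment> \<open>Here the chosen section is exchanged for the arbitrary section
      \<open>s'\<close>.\<close>
    also have "\<dots> = ?S `` {coflag_structure sE br g0 s' d}"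
      using s.equiv_ext_rel
        coflag_structure_section_independent[OF s.split_extension_axioms split[OF s'] d]
      by (rule equiv_class_eq)
    finally show ?thesis .
  qed
  with \<Phi> \<Theta> show ?thesis
    using s.equiv_ext_rel equiv_bij_betw[OF transfer_c] L.equiv_coflag_rel by blast
qed

end
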